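(* Let $k>0$, let $A\in\mathbb{C}^{m\times n}$ be a $k$-Hadamard matrix and let $v\in\mathbb{C}^n$ be a non-zero vector. For any $\varepsilon,\eta\in[0,1]$, \[ |\operatorname{supp}^1_\varepsilon(v)|\cdot|\operatorname{supp}^1_\eta(Av)|\ \ge\ k(1-\varepsilon)(1-\eta)\ \ge\ k(1-\varepsilon-\eta). \]
   Context: A matrix $A\in\mathbb{C}^{m\times n}$ is called $k$-Hadamard (for a real number $k>0$) if every entry of $A$ has absolute value at most $1$ and $\|A^*Av\|_\infty\ge k\|v\|_\infty$ for all $v\in\mathbb{C}^n$. For $u\in\mathbb{C}^N$, a set $T\subseteq\{1,\dots,N\}$ with complement $T^c$, $p\in[1,\infty]$ and $\delta\in[0,1]$, let $u[T]$ denote the restriction of $u$ to the coordinates in $T$; $u$ is $(p,\delta)$-supported on $T$ if $\|u[T^c]\|_p\le\delta\|u\|_p$. The $(p,\delta)$-support size of $u$ is \[ |\operatorname{supp}^p_\delta(u)|=\min\{|T|: T\subseteq\{1,\dots,N\},\ u\text{ is }(p,\delta)\text{-supported on }T\}. \] *)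

theory Defs
  imports "HOL-Analysis.Analysis"
begin

text \<open>
  \<open>lp_norm_on p T u\<close> is the p-norm of the restriction \<open>u[T]\<close> of \<open>u\<close> to the coordinates in \<open>T\<close>
  (meaningful for \<open>1 \<le> p\<close>), and \<open>lp_norm p u\<close> is the p-norm of \<open>u\<close> itself. The \<open>0\<close>
  inserted in the maximum only matters for the empty restriction. The library's \<open>infnorm\<close> cannot
  be used for \<open>p = \<infinity>\<close>: on complex vectors it is the maximum over real and imaginary parts, not
  over moduli.
\<close>

definition lp_norm_on :: "ennreal \<Rightarrow> 'i set \<Rightarrow> complex ^ 'i::finite \<Rightarrow> real" where
  "lp_norm_on p T u =
     (if p = \<infinity> then Max (insert 0 ((\<lambda>i. cmod (u $ i)) ` T))
      else (\<Sum>i\<in>T. cmod (u $ i) powr enn2real p) powr (1 / enn2real p))"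

abbreviation lp_norm :: "ennreal \<Rightarrow> complex ^ 'i::finite \<Rightarrow> real" where
  "lp_norm p u \<equiv> lp_norm_on p UNIV u"

definition conj_transpose :: "complex ^ 'n ^ 'm \<Rightarrow> complex ^ 'm ^ 'n" where
  "conj_transpose A = (\<chi> j i. cnj (A $ i $ j))"

definition k_Hadamard :: "real \<Rightarrow> complex ^ 'n::finite ^ 'm::finite \<Rightarrow> bool" where
  "k_Hadamard k A \<longleftrightarrow>
     (\<forall>i j. cmod (A $ i $ j) \<le> 1) \<and>
     (\<forall>v. lp_norm \<infinity> ((conj_transpose A ** A) *v v) \<ge> k * lp_norm \<infinity> v)"

definition supported_on :: "ennreal \<Rightarrow> real \<Rightarrow> complex ^ 'i::finite \<Rightarrow> 'i set \<Rightarrow> bool" where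
  "supported_on p \<delta> u T \<longleftrightarrow> lp_norm_on p (- T) u \<le> \<delta> * lp_norm p u"

definition supp_size :: "ennreal \<Rightarrow> real \<Rightarrow> complex ^ 'i::finite \<Rightarrow> nat" where
  "supp_size p \<delta> u = Min {card T |T. supported_on p \<delta> u T}"

end

theory Submission
  imports Defs
begin

text \<open>
  A vector with large norm quotient \<open>\<parallel>u\<parallel>\<^sub>1 / \<parallel>u\<parallel>\<^sub>\<infinity>\<close> cannot be concentrated on few
  coordinates: \<open>|T|\<close> coordinates carry at most \<open>|T| \<parallel>u\<parallel>\<^sub>\<infinity>\<close> of the mass \<open>\<parallel>u\<parallel>\<^sub>1\<close>, so
  carrying the fraction \<open>1 - \<delta>\<close> of it forces
  \<open>|supp\<^sub>\<delta> u| \<ge> (1 - \<delta>) \<parallel>u\<parallel>\<^sub>1 / \<parallel>u\<parallel>\<^sub>\<infinity>\<close> (lemma \<open>l1_norm_le_supp_size_linf_norm\<close>).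

  The uncertainty principle is therefore a lower bound on the product of the norm quotients of
  \<open>v\<close> and \<open>A v\<close>. As the entries of \<open>A\<close> have modulus at most 1, both \<open>A\<close> and its adjoint are
  contractions from the 1-norm to the maximum norm (lemma \<open>linf_norm_mult_le_l1_norm\<close>). For \<open>A\<close>
  this gives \<open>\<parallel>v\<parallel>\<^sub>1 \<ge> \<parallel>A v\<parallel>\<^sub>\<infinity>\<close>; for the adjoint, together with the Hadamard condition, it gives
  \<open>\<parallel>A v\<parallel>\<^sub>1 \<ge> \<parallel>A\<^sup>* A v\<parallel>\<^sub>\<infinity> \<ge> k \<parallel>v\<parallel>\<^sub>\<infinity>\<close>. Multiplied, these say that the product of the
  two quotients is at least \<open>k\<close> (lemma \<open>k_Hadamard_norm_uncertainty\<close>).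
\<close>

lemma l1_norm_on_eq_sum: "lp_norm_on 1 T u = (\<Sum>i\<in>T. cmod (u $ i))"
  by (simp add: lp_norm_on_def sum_nonneg)

lemma cmod_le_linf_norm: "cmod (u $ i) \<le> lp_norm \<infinity> u"
  unfolding lp_norm_on_def if_P[OF refl] by (rule Max_ge) simp_all

lemma linf_norm_nonneg: "0 \<le> lp_norm \<infinity> u"
  using cmod_le_linf_norm norm_ge_zero order_trans by blast

lemma linf_norm_le:
  assumes "\<And>i. cmod (u $ i) \<le> c"
  shows "lp_norm \<infinity> u \<le> c"
  using assms order_trans[OF norm_ge_zero assms] by (auto simp: lp_norm_on_def)

lemma linf_norm_pos:
  assumes "u \<noteq> 0"
  shows "0 < lp_norm \<infinity> u"
proof -
  obtain i where "u $ i \<noteq> 0"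
    using assms by (auto simp: vec_eq_iff)
  then show ?thesis
    using cmod_le_linf_norm[of u i] by (meson less_le_trans zero_less_norm_iff)
qed

lemma supp_size_attained:
  assumes "0 \<le> \<delta>"
  obtains T where "supported_on 1 \<delta> u T" "card T = supp_size 1 \<delta> u"
proof -
  have "supported_on 1 \<delta> u UNIV"
    using assms by (simp add: supported_on_def l1_norm_on_eq_sum sum_nonneg)
  then have "{card T |T. supported_on 1 \<delta> u T} \<noteq> {}"
    by blast
  moreover have "finite {card T |T. supported_on 1 \<delta> u T}"
    by simp
  ultimately have "supp_size 1 \<delta> u \<in> {card T |T. supported_on 1 \<delta> u T}"
    unfolding supp_size_def by (rule Min_in[rotated])
  then show thesis
    using that by auto
qed

text \<open>
  A set \<open>T\<close> of minimal size leaves at most \<open>\<delta> \<parallel>u\<parallel>\<^sub>1\<close> outside \<open>T\<close>, and each coordinate inside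
  \<open>T\<close> contributes at most \<open>\<parallel>u\<parallel>\<^sub>\<infinity>\<close>.
\<close>

lemma l1_norm_le_supp_size_linf_norm:
  assumes "0 \<le> \<delta>"
  shows "(1 - \<delta>) * lp_norm 1 u \<le> real (supp_size 1 \<delta> u) * lp_norm \<infinity> u"
proof -
  obtain T where T: "supported_on 1 \<delta> u T" "card T = supp_size 1 \<delta> u"
    using supp_size_attained[OF assms] .
  have "lp_norm 1 u = (\<Sum>i\<in>T. cmod (u $ i)) + lp_norm_on 1 (- T) u"
    by (simp add: l1_norm_on_eq_sum Compl_eq_Diff_UNIV sum.subset_diff[of T UNIV])
  moreover have "lp_norm_on 1 (- T) u \<le> \<delta> * lp_norm 1 u"
    using T(1) by (simp add: supported_on_def)
  moreover have "(\<Sum>i\<in>T. cmod (u $ i)) \<le> real (card T) * lp_norm \<infinity> u"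
    by (rule sum_bounded_above) (rule cmod_le_linf_norm)
  ultimately show ?thesis
    using T(2) by (simp add: algebra_simps)
qed

lemma linf_norm_mult_le_l1_norm:
  assumes "\<And>i j. cmod (B $ i $ j) \<le> 1"
  shows "lp_norm \<infinity> (B *v u) \<le> lp_norm 1 u"
proof (rule linf_norm_le)
  fix i
  have "cmod ((B *v u) $ i) \<le> (\<Sum>j\<in>UNIV. cmod (B $ i $ j * u $ j))"
    by (simp add: matrix_vector_mult_def norm_sum)
  also have "\<dots> \<le> lp_norm 1 u"
    unfolding l1_norm_on_eq_sum using assms
    by (intro sum_mono) (simp add: norm_mult mult_left_le_one_le)
  finally show "cmod ((B *v u) $ i) \<le> lp_norm 1 u" .
qed

lemma k_Hadamard_linf_norm_le_l1_norm_image: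
  assumes "k_Hadamard k A"
  shows "k * lp_norm \<infinity> v \<le> lp_norm 1 (A *v v)"
proof -
  have "k * lp_norm \<infinity> v \<le> lp_norm \<infinity> ((conj_transpose A ** A) *v v)"
    using assms by (simp add: k_Hadamard_def)
  also have "\<dots> = lp_norm \<infinity> (conj_transpose A *v (A *v v))"
    by (simp add: matrix_vector_mul_assoc)
  also have "\<dots> \<le> lp_norm 1 (A *v v)"
    using assms
    by (intro linf_norm_mult_le_l1_norm) (simp add: k_Hadamard_def conj_transpose_def)
  finally show ?thesis .
qed

lemma k_Hadamard_mult_nonzero:
  assumes "k > 0" "k_Hadamard k A" "v \<noteq> 0"
  shows "A *v v \<noteq> 0"
proof
  assume "A *v v = 0"
  then have "k * lp_norm \<infinity> v \<le> 0"
    using k_Hadamard_linf_norm_le_l1_norm_image[OF assms(2), of v]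
    by (simp add: l1_norm_on_eq_sum)
  then show False
    using mult_pos_pos[OF assms(1) linf_norm_pos[OF assms(3)]] by linarith
qed

text \<open>
  The uncertainty principle for norms, free of supports. The two factors on the right swap roles:
  \<open>\<parallel>v\<parallel>\<^sub>1\<close> pays for \<open>\<parallel>A v\<parallel>\<^sub>\<infinity>\<close> and \<open>\<parallel>A v\<parallel>\<^sub>1\<close> pays for \<open>k \<parallel>v\<parallel>\<^sub>\<infinity>\<close>.
\<close>

lemma k_Hadamard_norm_uncertainty:
  assumes "k > 0" "k_Hadamard k A"
  shows "k * (lp_norm \<infinity> v * lp_norm \<infinity> (A *v v)) \<le> lp_norm 1 v * lp_norm 1 (A *v v)"
proof -
  have "lp_norm \<infinity> (A *v v) \<le> lp_norm 1 v"
    using assms(2) by (intro linf_norm_mult_le_l1_norm) (simp add: k_Hadamard_def)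
  then have "lp_norm \<infinity> (A *v v) * (k * lp_norm \<infinity> v) \<le> lp_norm 1 v * lp_norm 1 (A *v v)"
    using k_Hadamard_linf_norm_le_l1_norm_image[OF assms(2), of v] assms(1)
    by (intro mult_mono mult_nonneg_nonneg linf_norm_nonneg)
       (simp_all add: l1_norm_on_eq_sum sum_nonneg)
  then show ?thesis
    by (simp add: mult_ac)
qed

theorem theorem3p17:
  fixes k \<epsilon> \<eta> :: real
    and A :: "complex ^ 'n::finite ^ 'm::finite"
    and v :: "complex ^ 'n::finite"
  assumes "k > 0"
    and "k_Hadamard k A"
    and "v \<noteq> 0"
    and "\<epsilon> \<in> {0..1}"
    and "\<eta> \<in> {0..1}"
  shows "real (supp_size 1 \<epsilon> v) * real (supp_size 1 \<eta> (A *v v)) \<ge> k * (1 - \<epsilon>) * (1 - \<eta>) \<and>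
         k * (1 - \<epsilon>) * (1 - \<eta>) \<ge> k * (1 - \<epsilon> - \<eta>)"
proof
  let ?s = "real (supp_size 1 \<epsilon> v)" and ?t = "real (supp_size 1 \<eta> (A *v v))"
  define M where "M = lp_norm \<infinity> v * lp_norm \<infinity> (A *v v)"
  have "M > 0"
    unfolding M_def using assms k_Hadamard_mult_nonzero[OF assms(1-3)]
    by (intro mult_pos_pos linf_norm_pos)
  have "k * (1 - \<epsilon>) * (1 - \<eta>) * M = (1 - \<epsilon>) * (1 - \<eta>) * (k * M)"
    by (simp add: mult_ac)
  also have "\<dots> \<le> (1 - \<epsilon>) * (1 - \<eta>) * (lp_norm 1 v * lp_norm 1 (A *v v))"
    unfolding M_def using assms
    by (intro mult_left_mono k_Hadamard_norm_uncertainty) simp_all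
  also have "\<dots> = ((1 - \<epsilon>) * lp_norm 1 v) * ((1 - \<eta>) * lp_norm 1 (A *v v))"
    by (simp add: mult_ac)
  also have "\<dots> \<le> (?s * lp_norm \<infinity> v) * (?t * lp_norm \<infinity> (A *v v))"
    using assms(4,5)
    by (intro mult_mono l1_norm_le_supp_size_linf_norm mult_nonneg_nonneg linf_norm_nonneg)
       (simp_all add: l1_norm_on_eq_sum sum_nonneg)
  also have "\<dots> = ?s * ?t * M"
    by (simp add: M_def mult_ac)
  finally show "k * (1 - \<epsilon>) * (1 - \<eta>) \<le> ?s * ?t"
    using \<open>M > 0\<close> by (rule mult_right_le_imp_le)
next
  have "0 \<le> k * (\<epsilon> * \<eta>)"
    using assms by simp
  then show "k * (1 - \<epsilon> - \<eta>) \<le> k * (1 - \<epsilon>) * (1 - \<eta>)"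
    by (simp add: algebra_simps)
qed

end
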